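(* Let $L=L_1\times\cdots\times L_p$ be a product of finite lattices $L_1,\dots,L_p$ with the componentwise order, let $\Sigma$ be a control network over $L$, and let $\Sigma_1,\dots,\Sigma_p$ be its factor systems over $L_1,\dots,L_p$. Then $\Sigma$ is controllable (respectively observable, synchronizable, stabilizable) if and only if all the factor systems $\Sigma_i$, $i=1,\dots,p$, are controllable (respectively observable, synchronizable, stabilizable).
   Context: Lattice functions. For a finite lattice $L$ with join $\vee$ and meet $\wedge$, a function $F:L^N\to L$ is a lattice function if it is obtained by composition of $\vee$ and $\wedge$ from its variables, i.e. $F(x_1,\dots,x_N)=x_{i_1}\bigcirc x_{i_2}\bigcirc\cdots\bigcirc x_{i_r}$ up to inserting parentheses, where $i_1,\dots,i_r\in\{1,\dots,N\}$, $r>0$, and each $\bigcirc$ is $\vee$ or $\wedge$ (no constants). Control network over $L$. States $x_1(t),\dots,x_n(t)\in L$, controls $u_1(t),\dots,u_m(t)\in L$, $t=0,1,2,\dots$, with dynamics $x_j(t+1)=g_j(x_1(t),\dots,x_n(t);u_1(t),\dots,u_m(t))$, $j=1,\dots,n$, where each $g_j$ is a lattice function. When observability is considered, the network also has outputs $y_l(t)=h_l(x_1(t),\dots,x_n(t))\in L$, $l=1,\dots,q$, with each $h_l$ a lattice function. Write $x(t)=(x_1(t),\dots,x_n(t))$, $u(t)=(u_1(t),\dots,u_m(t))$, $y(t)=(y_1(t),\dots,y_q(t))$. Product lattice and factor systems. On $L=L_1\times\cdots\times L_p$ the order is $(a_1,\dots,a_p)\leqslant(b_1,\dots,b_p)\Leftrightarrow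 a_i\leqslant b_i$ for all $i$, so $\vee,\wedge$ act componentwise. The factor system $\Sigma_i$ is the network over $L_i$ with $n$ state nodes, $m$ controls (and $q$ outputs) obtained by taking the $i$-th components of all states, controls (and outputs) of $\Sigma$, i.e. the same lattice expressions $g_j$ (and $h_l$) evaluated with the operations of $L_i$. Control properties (usual meaning for logical networks). Controllable: for any two states $x^0,x^d$ there are $T\ge1$ and a control sequence steering $x(0)=x^0$ to $x(T)=x^d$. Observable: for any two distinct initial states there is a control sequence for which the two corresponding output sequences $(y(t))_{t\ge0}$ differ. Synchronizable: for every initial state there are a control sequence and $T\ge0$ such that $x_1(t)=\cdots=x_n(t)$ for all $t\ge T$. Stabilizable: there is a state $x^e$ such that for every initial state there are a control sequence and $T\ge 0$ with $x(t)=x^e$ for all $t\ge T$. *)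

theory Defs
  imports "HOL-Algebra.Lattice"
begin

section \<open>Product lattices\<close>

definition prod_lattice :: "('p \<Rightarrow> 'a gorder) \<Rightarrow> ('p \<Rightarrow> 'a) gorder" where
  "prod_lattice Ls =
    \<lparr>carrier = {a. \<forall>i. a i \<in> carrier (Ls i)},
     eq = (=),
     le = (\<lambda>a b. \<forall>i. le (Ls i) (a i) (b i))\<rparr>"

section \<open>Lattice functions\<close>

datatype 'v lattice_expr =
    Var 'v
  | Join "'v lattice_expr" "'v lattice_expr"
  | Meet "'v lattice_expr" "'v lattice_expr"

primrec lattice_fun :: "'a gorder \<Rightarrow> 'v lattice_expr \<Rightarrow> ('v \<Rightarrow> 'a) \<Rightarrow> 'a" where
  "lattice_fun L (Var v) x = x v"
| "lattice_fun L (Join e f) x = lattice_fun L e x \<squnion>\<^bsub>L\<^esub> lattice_fun L f x"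
| "lattice_fun L (Meet e f) x = lattice_fun L e x \<sqinter>\<^bsub>L\<^esub> lattice_fun L f x"

section \<open>Control networks over a lattice\<close>

text \<open>
  A network over \<open>L\<close> with state nodes \<open>'n\<close>, controls \<open>'m\<close> and outputs \<open>'q\<close> is given by \<open>L\<close>, by
  one expression \<open>g j\<close> per state node, with variables \<open>Inl k\<close> (state \<open>k\<close>) and \<open>Inr k\<close>
  (control \<open>k\<close>), and by one expression \<open>h l\<close> per output, over the states only.
  If \<open>L\<close> is \<open>prod_lattice Ls\<close>, the factor system at \<open>i\<close> is given by \<open>Ls i\<close>, \<open>g\<close> and \<open>h\<close>;
  lemmas \<open>trajectory_component\<close> and \<open>out_seq_component\<close> below show that it consists of the
  \<open>i\<close>-th components of all states, controls and outputs.
\<close>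

definition points :: "'a gorder \<Rightarrow> ('k \<Rightarrow> 'a) set" where
  "points L = {v. \<forall>k. v k \<in> carrier L}"

definition controls :: "'a gorder \<Rightarrow> (nat \<Rightarrow> 'm \<Rightarrow> 'a) set" where
  "controls L = {u. \<forall>t. u t \<in> points L}"

primrec trajectory ::
  "'a gorder \<Rightarrow> ('n \<Rightarrow> ('n + 'm) lattice_expr) \<Rightarrow> ('n \<Rightarrow> 'a) \<Rightarrow> (nat \<Rightarrow> 'm \<Rightarrow> 'a) \<Rightarrow> nat \<Rightarrow> 'n \<Rightarrow> 'a"
where
  "trajectory L g x0 u 0 = x0"
| "trajectory L g x0 u (Suc t) =
     (\<lambda>j. lattice_fun L (g j) (case_sum (trajectory L g x0 u t) (u t)))"

definition out_seq ::
  "'a gorder \<Rightarrow> ('n \<Rightarrow> ('n + 'm) lattice_expr) \<Rightarrow> ('q \<Rightarrow> 'n lattice_expr) \<Rightarrow>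
   ('n \<Rightarrow> 'a) \<Rightarrow> (nat \<Rightarrow> 'm \<Rightarrow> 'a) \<Rightarrow> nat \<Rightarrow> 'q \<Rightarrow> 'a"
where
  "out_seq L g h x0 u t = (\<lambda>l. lattice_fun L (h l) (trajectory L g x0 u t))"

definition controllable :: "'a gorder \<Rightarrow> ('n \<Rightarrow> ('n + 'm) lattice_expr) \<Rightarrow> bool" where
  "controllable L g \<longleftrightarrow>
    (\<forall>x0\<in>points L. \<forall>xd\<in>points L. \<exists>T\<ge>1. \<exists>u\<in>controls L. trajectory L g x0 u T = xd)"

definition observable ::
  "'a gorder \<Rightarrow> ('n \<Rightarrow> ('n + 'm) lattice_expr) \<Rightarrow> ('q \<Rightarrow> 'n lattice_expr) \<Rightarrow> bool"
where
  "observable L g h \<longleftrightarrow>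
    (\<forall>x\<in>points L. \<forall>x'\<in>points L. x \<noteq> x' \<longrightarrow>
      (\<exists>u\<in>controls L. out_seq L g h x u \<noteq> out_seq L g h x' u))"

definition synchronizable :: "'a gorder \<Rightarrow> ('n \<Rightarrow> ('n + 'm) lattice_expr) \<Rightarrow> bool" where
  "synchronizable L g \<longleftrightarrow>
    (\<forall>x0\<in>points L. \<exists>u\<in>controls L. \<exists>T. \<forall>t\<ge>T. \<forall>j k.
      trajectory L g x0 u t j = trajectory L g x0 u t k)"

definition stabilizable :: "'a gorder \<Rightarrow> ('n \<Rightarrow> ('n + 'm) lattice_expr) \<Rightarrow> bool" where
  "stabilizable L g \<longleftrightarrow>
    (\<exists>xe\<in>points L. \<forall>x0\<in>points L. \<exists>u\<in>controls L. \<exists>T. \<forall>t\<ge>T. trajectory L g x0 u t = xe)"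

section \<open>Componentwise evaluation in product lattices\<close>

lemma least_prod_lattice:
  assumes L: "\<And>i. lattice (Ls i)"
    and a: "a \<in> carrier (prod_lattice Ls)" and b: "b \<in> carrier (prod_lattice Ls)"
  shows "least (prod_lattice Ls) (\<lambda>i. a i \<squnion>\<^bsub>Ls i\<^esub> b i) (Upper (prod_lattice Ls) {a, b})"
proof -
  have c: "a i \<in> carrier (Ls i)" "b i \<in> carrier (Ls i)" for i
    using a b by (simp_all add: prod_lattice_def)
  interpret L: lattice "Ls i" for i by (rule L)
  show ?thesis
    unfolding least_def Upper_def
    by (auto simp: prod_lattice_def c L.join_left L.join_right intro!: L.join_le)
qed

lemma greatest_prod_lattice:
  assumes L: "\<And>i. lattice (Ls i)"
    and a: "a \<in> carrier (prod_lattice Ls)" and b: "b \<in> carrier (prod_lattice Ls)"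
  shows "greatest (prod_lattice Ls) (\<lambda>i. a i \<sqinter>\<^bsub>Ls i\<^esub> b i) (Lower (prod_lattice Ls) {a, b})"
proof -
  have c: "a i \<in> carrier (Ls i)" "b i \<in> carrier (Ls i)" for i
    using a b by (simp_all add: prod_lattice_def)
  interpret L: lattice "Ls i" for i by (rule L)
  show ?thesis
    unfolding greatest_def Lower_def
    by (auto simp: prod_lattice_def c L.meet_left L.meet_right intro!: L.meet_le)
qed

lemma partial_order_prod_lattice:
  assumes "\<And>i. lattice (Ls i)"
  shows "partial_order (prod_lattice Ls)"
proof -
  interpret L: lattice "Ls i" for i by (rule assms)
  show ?thesis
  proof
    fix x y z
    assume "le (prod_lattice Ls) x y" "le (prod_lattice Ls) y z"
      and "x \<in> carrier (prod_lattice Ls)" "y \<in> carrier (prod_lattice Ls)"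
        "z \<in> carrier (prod_lattice Ls)"
    then show "le (prod_lattice Ls) x z"
      by (auto simp: prod_lattice_def intro: L.le_trans)
  next
    fix x y
    assume "le (prod_lattice Ls) x y" "le (prod_lattice Ls) y x"
      and "x \<in> carrier (prod_lattice Ls)" "y \<in> carrier (prod_lattice Ls)"
    then have "x i = y i" for i
      by (intro L.le_antisym[of i]) (simp_all add: prod_lattice_def)
    then show "x .=\<^bsub>prod_lattice Ls\<^esub> y"
      by (auto simp: prod_lattice_def)
  qed (auto simp: prod_lattice_def)
qed

lemma lattice_prod_lattice:
  assumes "\<And>i. lattice (Ls i)"
  shows "lattice (prod_lattice Ls)"
proof -
  interpret partial_order "prod_lattice Ls" by (rule partial_order_prod_lattice[OF assms])
  show ?thesis
  proof
    fix x y assume "x \<in> carrier (prod_lattice Ls)" "y \<in> carrier (prod_lattice Ls)"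
    note xy = this
    show "\<exists>s. least (prod_lattice Ls) s (Upper (prod_lattice Ls) {x, y})"
      using least_prod_lattice[where Ls = Ls, OF assms xy] by blast
    show "\<exists>s. greatest (prod_lattice Ls) s (Lower (prod_lattice Ls) {x, y})"
      using greatest_prod_lattice[where Ls = Ls, OF assms xy] by blast
  qed
qed

lemma join_prod_lattice:
  assumes "\<And>i. lattice (Ls i)"
    and "a \<in> carrier (prod_lattice Ls)" "b \<in> carrier (prod_lattice Ls)"
  shows "a \<squnion>\<^bsub>prod_lattice Ls\<^esub> b = (\<lambda>i. a i \<squnion>\<^bsub>Ls i\<^esub> b i)"
proof -
  interpret P: lattice "prod_lattice Ls" by (rule lattice_prod_lattice[OF assms(1)])
  show ?thesis
    using P.sup_of_two_least[OF assms(2,3)] least_prod_lattice[OF assms]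
    unfolding join_def by (rule P.least_unique)
qed

lemma meet_prod_lattice:
  assumes "\<And>i. lattice (Ls i)"
    and "a \<in> carrier (prod_lattice Ls)" "b \<in> carrier (prod_lattice Ls)"
  shows "a \<sqinter>\<^bsub>prod_lattice Ls\<^esub> b = (\<lambda>i. a i \<sqinter>\<^bsub>Ls i\<^esub> b i)"
proof -
  interpret P: lattice "prod_lattice Ls" by (rule lattice_prod_lattice[OF assms(1)])
  show ?thesis
    using P.inf_of_two_greatest[OF assms(2,3)] greatest_prod_lattice[OF assms]
    unfolding meet_def by (rule P.greatest_unique)
qed

lemma lattice_fun_closed:
  assumes "lattice L" "\<And>v. x v \<in> carrier L"
  shows "lattice_fun L e x \<in> carrier L"
proof -
  interpret lattice L by fact
  show ?thesis using assms(2) by (induction e) auto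
qed

lemma lattice_fun_component:
  assumes L: "\<And>i. lattice (Ls i)" and x: "\<And>v. x v \<in> carrier (prod_lattice Ls)"
  shows "lattice_fun (prod_lattice Ls) e x i = lattice_fun (Ls i) e (\<lambda>v. x v i)"
  by (induction e)
    (simp_all add: join_prod_lattice[OF L] meet_prod_lattice[OF L]
      lattice_fun_closed[OF lattice_prod_lattice[OF L] x])

lemma trajectory_closed:
  assumes "lattice L" "x0 \<in> points L" "u \<in> controls L"
  shows "trajectory L g x0 u t \<in> points L"
  using assms
  by (induction t)
    (auto simp: points_def controls_def intro!: lattice_fun_closed split: sum.split)

lemma trajectory_component:
  assumes L: "\<And>i. lattice (Ls i)"
    and x0: "x0 \<in> points (prod_lattice Ls)" and u: "u \<in> controls (prod_lattice Ls)"
  shows "trajectory (prod_lattice Ls) g x0 u t j i =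
    trajectory (Ls i) g (\<lambda>k. x0 k i) (\<lambda>t k. u t k i) t j"
proof (induction t arbitrary: j)
  case (Suc t)
  let ?x = "trajectory (prod_lattice Ls) g x0 u t"
  have "case_sum ?x (u t) v \<in> carrier (prod_lattice Ls)" for v
    using trajectory_closed[OF lattice_prod_lattice[OF L] x0 u] u
    by (auto simp: points_def controls_def split: sum.split)
  moreover have "(\<lambda>v. case_sum ?x (u t) v i) =
      case_sum (trajectory (Ls i) g (\<lambda>k. x0 k i) (\<lambda>t k. u t k i) t) (\<lambda>k. u t k i)"
    by (auto simp: Suc.IH split: sum.split)
  ultimately show ?case
    by (simp add: lattice_fun_component[OF L])
qed simp

lemma out_seq_component:
  assumes L: "\<And>i. lattice (Ls i)"
    and x0: "x0 \<in> points (prod_lattice Ls)" and u: "u \<in> controls (prod_lattice Ls)"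
  shows "out_seq (prod_lattice Ls) g h x0 u t l i =
    out_seq (Ls i) g h (\<lambda>k. x0 k i) (\<lambda>t k. u t k i) t l"
proof -
  have "trajectory (prod_lattice Ls) g x0 u t v \<in> carrier (prod_lattice Ls)" for v
    using trajectory_closed[OF lattice_prod_lattice[OF L] x0 u] by (auto simp: points_def)
  then show ?thesis
    by (simp add: out_seq_def lattice_fun_component[OF L] trajectory_component[OF L x0 u])
qed

end

(*
  By componentwise evaluation, a trajectory of the product network is precisely a tuple of
  trajectories of the factor systems, and the factor trajectories can be chosen independently;
  what remains is to align the times at which the factors reach their goals. For
  synchronization and stabilization one takes the maximum of these times. For controllability,
  note that without constants every lattice function is idempotent, so a state with all nodes
  equal to a is kept by the control with all entries equal to a: each factor can be steered to
  such a state, wait there as long as needed, and then move on to its target.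
*)
theory Submission
  imports Defs
begin

section \<open>Waiting at constant states\<close>

text \<open>Join and meet are idempotent and the leaves of an expression are variables only, so
  every subexpression evaluates to \<open>a\<close>.\<close>

lemma lattice_fun_const:
  assumes "lattice L" and "a \<in> carrier L"
  shows "lattice_fun L e (\<lambda>_. a) = a"
proof -
  interpret lattice L by fact
  have "a \<squnion>\<^bsub>L\<^esub> a = a" "a \<sqinter>\<^bsub>L\<^esub> a = a"
    using assms(2) by (auto intro!: le_antisym join_le meet_le simp: join_left meet_left)
  then show ?thesis by (induction e) simp_all
qed

lemma trajectory_const:
  assumes "lattice L" and "a \<in> carrier L"
  shows "trajectory L g (\<lambda>_. a) (\<lambda>_ _. a) t = (\<lambda>_. a)"
proof (induction t)
  case (Suc t)
  have "case_sum (\<lambda>_. a) (\<lambda>_. a) = (\<lambda>_. a)"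
    by (auto split: sum.split)
  with Suc show ?case by (simp add: lattice_fun_const[OF assms])
qed simp

text \<open>Concatenation at time \<open>s\<close>; the second sequence is read from its own time 0,
  whence the shift \<open>t - s\<close>.\<close>

definition switch_control :: "nat \<Rightarrow> (nat \<Rightarrow> 'b) \<Rightarrow> (nat \<Rightarrow> 'b) \<Rightarrow> nat \<Rightarrow> 'b" where
  "switch_control s u v t = (if t < s then u t else v (t - s))"

lemma switch_control_in_controls:
  assumes "u \<in> controls L" and "v \<in> controls L"
  shows "switch_control s u v \<in> controls L"
  using assms by (simp add: controls_def switch_control_def)

text \<open>Causality of the dynamics: the inputs at time \<open>t\<close> and later act only after
  the state at time \<open>t\<close>.\<close>

lemma trajectory_cong:
  assumes "\<And>r. r < t \<Longrightarrow> u r = v r"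
  shows "trajectory L g x u t = trajectory L g x v t"
  using assms
proof (induction t)
  case (Suc t)
  have "u t = v t" by (rule Suc.prems) simp
  moreover have "trajectory L g x u t = trajectory L g x v t"
    by (rule Suc.IH) (rule Suc.prems, simp)
  ultimately show ?case by simp
qed simp

text \<open>The update rule does not depend on time, so after the switch the network runs afresh
  from the state reached at time \<open>s\<close>.\<close>

lemma trajectory_switch_control:
  "trajectory L g x (switch_control s u v) (s + t) =
    trajectory L g (trajectory L g x u s) v t"
proof (induction t)
  case 0
  \<comment> \<open>Before time \<open>s\<close> the concatenation agrees with \<open>u\<close>, and
    causality discards the rest.\<close>
  show ?case by (auto simp: switch_control_def intro!: trajectory_cong)
qed (simp add: switch_control_def)

text \<open>Controllability supplies a single arrival time for each pair of states. A detour through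
  a constant state, where any delay can be inserted, makes every sufficiently late time an arrival
  time, so that different factors can arrive together.\<close>

lemma controllable_steer_uniformly:
  assumes L: "lattice L" and ne: "carrier L \<noteq> {}" and "controllable L g"
    and x: "x \<in> points L" and y: "y \<in> points L"
  obtains T where "1 \<le> T"
    and "\<And>S. T \<le> S \<Longrightarrow> \<exists>u\<in>controls L. trajectory L g x u S = y"
proof -
  obtain a where a: "a \<in> carrier L" using ne by blast
  then have ac: "(\<lambda>_. a) \<in> points L" "(\<lambda>_ _. a) \<in> controls L"
    by (simp_all add: points_def controls_def)
  obtain T1 u1 where u1: "1 \<le> T1" "u1 \<in> controls L" "trajectory L g x u1 T1 = (\<lambda>_. a)"
    using assms(3) x ac(1) unfolding controllable_def by blast
  obtain T2 u2 where u2: "u2 \<in> controls L" "trajectory L g (\<lambda>_. a) u2 T2 = y"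
    using assms(3) y ac(1) unfolding controllable_def by blast
  have "\<exists>u\<in>controls L. trajectory L g x u S = y" if "T1 + T2 \<le> S" for S
  proof
    \<comment> \<open>The surplus time, spent waiting at the constant state between the two steering
      phases.\<close>
    define w where "w = S - (T1 + T2)"
    have S: "S = T1 + (w + T2)" using that by (simp add: w_def)
    let ?u = "switch_control T1 u1 (switch_control w (\<lambda>_ _. a) u2)"
    show "?u \<in> controls L"
      by (intro switch_control_in_controls u1 u2 ac)
    show "trajectory L g x ?u S = y"
      unfolding S trajectory_switch_control
      by (simp add: u1 u2 trajectory_const[OF L a])
  qed
  with u1(1) show thesis by (intro that[of "T1 + T2"]) auto
qed

section \<open>Tupling and projection\<close>

text \<open>A family of factor states takes the factor index first, a product state takes the node
  first; the abstraction transposes the two arguments.\<close>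

lemma tuple_in_points:
  "(\<lambda>k i. x i k) \<in> points (prod_lattice Ls) \<longleftrightarrow> (\<forall>i. x i \<in> points (Ls i))"
  unfolding points_def prod_lattice_def by simp blast

lemma tuple_in_controls:
  "(\<lambda>t k i. u i t k) \<in> controls (prod_lattice Ls) \<longleftrightarrow> (\<forall>i. u i \<in> controls (Ls i))"
  unfolding controls_def points_def prod_lattice_def by simp blast

lemma component_in_points:
  "x \<in> points (prod_lattice Ls) \<Longrightarrow> (\<lambda>k. x k i) \<in> points (Ls i)"
  by (simp add: points_def prod_lattice_def)

lemma component_in_controls:
  "u \<in> controls (prod_lattice Ls) \<Longrightarrow> (\<lambda>t k. u t k i) \<in> controls (Ls i)"
  by (simp add: controls_def points_def prod_lattice_def)

text \<open>The lift behind the passage from the product to a factor: the remaining components are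
  filled with arbitrary constants, which requires all factors to be nonempty.\<close>

lemma ex_point_component:
  assumes ne: "\<And>i. carrier (Ls i) \<noteq> {}" and x: "x \<in> points (Ls i)"
  obtains x' where "x' \<in> points (prod_lattice Ls)" "(\<lambda>k. x' k i) = x"
proof -
  define b where "b = (\<lambda>j. SOME a. a \<in> carrier (Ls j))"
  have b: "b j \<in> carrier (Ls j)" for j
    using ne by (simp add: b_def some_in_eq)
  define z where "z = (\<lambda>j. if j = i then x else (\<lambda>_. b j))"
  have "(\<lambda>k j. z j k) \<in> points (prod_lattice Ls)"
    unfolding tuple_in_points using x b by (auto simp: z_def points_def)
  then show thesis by (rule that) (simp add: z_def)
qed

lemma ex_control_component:
  assumes ne: "\<And>i. carrier (Ls i) \<noteq> {}" and u: "u \<in> controls (Ls i)"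
  obtains u' where "u' \<in> controls (prod_lattice Ls)" "(\<lambda>t k. u' t k i) = u"
proof -
  define b where "b = (\<lambda>j. SOME a. a \<in> carrier (Ls j))"
  have b: "b j \<in> carrier (Ls j)" for j
    using ne by (simp add: b_def some_in_eq)
  define z where "z = (\<lambda>j. if j = i then u else (\<lambda>_ _. b j))"
  have "(\<lambda>t k j. z j t k) \<in> controls (prod_lattice Ls)"
    unfolding tuple_in_controls using u b by (auto simp: z_def controls_def points_def)
  then show thesis by (rule that) (simp add: z_def)
qed

text \<open>There are finitely many factors, so the maximum of the individual thresholds is a
  threshold for all of them.\<close>

lemma ex_common_bound:
  fixes P :: "'p::finite \<Rightarrow> nat \<Rightarrow> bool"
  assumes "\<forall>i. \<exists>T. \<forall>t\<ge>T. P i t"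
  shows "\<exists>T. \<forall>t\<ge>T. \<forall>i. P i t"
proof -
  obtain T where "\<forall>i. \<forall>t\<ge>T i. P i t"
    using choice[OF assms] by blast
  then have "\<forall>t\<ge>Max (range T). \<forall>i. P i t"
    by simp
  then show ?thesis ..
qed

section \<open>Control properties of product networks\<close>

context
  fixes Ls :: "'p::finite \<Rightarrow> 'a gorder"
  assumes L: "\<And>i. lattice (Ls i)"
    and ne: "\<And>i. carrier (Ls i) \<noteq> {}"
begin

lemma trajectory_eqI:
  assumes "x \<in> points (prod_lattice Ls)" "u \<in> controls (prod_lattice Ls)"
    and "\<And>i. trajectory (Ls i) g (\<lambda>k. x k i) (\<lambda>t k. u t k i) t = (\<lambda>k. y k i)"
  shows "trajectory (prod_lattice Ls) g x u t = y"
proof (intro ext)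
  fix j i
  show "trajectory (prod_lattice Ls) g x u t j i = y j i"
    unfolding trajectory_component[OF L assms(1,2)] assms(3) ..
qed

text \<open>From product to factor, lift both endpoints and project the steering control.
  Conversely, steer all factors so that they arrive at one common time.\<close>

lemma controllable_prod_lattice:
  fixes g :: "'n \<Rightarrow> ('n + 'm) lattice_expr"
  shows "controllable (prod_lattice Ls) g \<longleftrightarrow> (\<forall>i. controllable (Ls i) g)"
proof
  assume ctrl: "controllable (prod_lattice Ls) g"
  show "\<forall>i. controllable (Ls i) g"
    unfolding controllable_def
  proof (intro allI ballI)
    fix i and x y :: "'n \<Rightarrow> 'a"
    assume "x \<in> points (Ls i)" "y \<in> points (Ls i)"
    note xy = this
    obtain x' where x': "x' \<in> points (prod_lattice Ls)" "(\<lambda>k. x' k i) = x"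
      using xy(1) by (rule ex_point_component[of Ls, OF ne])
    obtain y' where y': "y' \<in> points (prod_lattice Ls)" "(\<lambda>k. y' k i) = y"
      using xy(2) by (rule ex_point_component[of Ls, OF ne])
    obtain T u where T: "1 \<le> T" and u: "u \<in> controls (prod_lattice Ls)"
      and tr: "trajectory (prod_lattice Ls) g x' u T = y'"
      using ctrl x'(1) y'(1) unfolding controllable_def by blast
    have "trajectory (Ls i) g x (\<lambda>t k. u t k i) T = y"
      using trajectory_component[OF L x'(1) u, of g T _ i] tr x'(2) y'(2)
      by (auto simp: fun_eq_iff)
    then show "\<exists>T\<ge>1. \<exists>u\<in>controls (Ls i). trajectory (Ls i) g x u T = y"
      using T component_in_controls[OF u] by blast
  qed
next
  assume ctrl: "\<forall>i. controllable (Ls i) g"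
  show "controllable (prod_lattice Ls) g"
    unfolding controllable_def
  proof (intro ballI)
    fix x y :: "'n \<Rightarrow> 'p \<Rightarrow> 'a"
    assume x: "x \<in> points (prod_lattice Ls)" and y: "y \<in> points (prod_lattice Ls)"
    \<comment> \<open>Including \<open>1 \<le> S\<close> in the eventual property lets the common
      time inherit the lower bound required by controllability.\<close>
    have "\<exists>T. \<forall>S\<ge>T. 1 \<le> S \<and>
        (\<exists>u\<in>controls (Ls i). trajectory (Ls i) g (\<lambda>k. x k i) u S = (\<lambda>k. y k i))" for i
      by (rule controllable_steer_uniformly[OF L ne ctrl[rule_format]
          component_in_points[OF x] component_in_points[OF y], of i]) (meson order_trans)
    then have "\<forall>i. \<exists>T. \<forall>S\<ge>T. 1 \<le> S \<and>
        (\<exists>u\<in>controls (Ls i). trajectory (Ls i) g (\<lambda>k. x k i) u S = (\<lambda>k. y k i))" ..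
    from ex_common_bound[OF this] obtain T where T: "1 \<le> T"
      and "\<forall>i. \<exists>u\<in>controls (Ls i). trajectory (Ls i) g (\<lambda>k. x k i) u T = (\<lambda>k. y k i)"
      by blast
    then obtain u where u: "\<forall>i. u i \<in> controls (Ls i)"
      and tr: "\<forall>i. trajectory (Ls i) g (\<lambda>k. x k i) (u i) T = (\<lambda>k. y k i)"
      unfolding Bex_def by (auto dest!: choice)
    have u': "(\<lambda>t k i. u i t k) \<in> controls (prod_lattice Ls)"
      using u by (simp add: tuple_in_controls)
    moreover have "trajectory (prod_lattice Ls) g x (\<lambda>t k i. u i t k) T = y"
      by (rule trajectory_eqI[OF x u']) (simp add: tr)
    ultimately show
      "\<exists>T\<ge>1. \<exists>u\<in>controls (prod_lattice Ls). trajectory (prod_lattice Ls) g x u T = y"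
      using T by blast
  qed
qed

text \<open>Output sequences of the product differ as soon as they differ in one component at one
  time, so a single distinguishing factor suffices.\<close>

lemma observable_prod_lattice:
  fixes g :: "'n \<Rightarrow> ('n + 'm) lattice_expr" and h :: "'q \<Rightarrow> 'n lattice_expr"
  shows "observable (prod_lattice Ls) g h \<longleftrightarrow> (\<forall>i. observable (Ls i) g h)"
proof
  assume obs: "observable (prod_lattice Ls) g h"
  show "\<forall>i. observable (Ls i) g h"
    unfolding observable_def
  proof (intro allI ballI impI)
    fix i and x y :: "'n \<Rightarrow> 'a"
    assume x: "x \<in> points (Ls i)" and y: "y \<in> points (Ls i)" and neq: "x \<noteq> y"
    obtain x' where x': "x' \<in> points (prod_lattice Ls)" "(\<lambda>k. x' k i) = x"
      using ex_point_component[of Ls, OF ne x] by blast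
    \<comment> \<open>The two states agree outside component \<open>i\<close>, so only that component of the outputs can
      tell them apart.\<close>
    define y' where "y' = (\<lambda>k. (x' k)(i := y k))"
    have y': "y' \<in> points (prod_lattice Ls)" "(\<lambda>k. y' k i) = y"
      using x'(1) y by (auto simp: y'_def points_def prod_lattice_def)
    have "x' \<noteq> y'" using x'(2) y'(2) neq by auto
    then obtain u where u: "u \<in> controls (prod_lattice Ls)"
      and "out_seq (prod_lattice Ls) g h x' u \<noteq> out_seq (prod_lattice Ls) g h y' u"
      using obs x'(1) y'(1) unfolding observable_def by blast
    then obtain t l j where
      "out_seq (prod_lattice Ls) g h x' u t l j \<noteq> out_seq (prod_lattice Ls) g h y' u t l j"
      by (auto simp: fun_eq_iff)
    then have diff: "out_seq (Ls j) g h (\<lambda>k. x' k j) (\<lambda>t k. u t k j) t l \<noteq>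
        out_seq (Ls j) g h (\<lambda>k. y' k j) (\<lambda>t k. u t k j) t l"
      by (simp add: out_seq_component[OF L x'(1) u] out_seq_component[OF L y'(1) u])
    then have "j = i" by (rule contrapos_np) (simp add: y'_def)
    with diff x'(2) y'(2) have
      "out_seq (Ls i) g h x (\<lambda>t k. u t k i) \<noteq> out_seq (Ls i) g h y (\<lambda>t k. u t k i)"
      by auto
    then show "\<exists>u\<in>controls (Ls i). out_seq (Ls i) g h x u \<noteq> out_seq (Ls i) g h y u"
      using component_in_controls[OF u] by blast
  qed
next
  assume obs: "\<forall>i. observable (Ls i) g h"
  show "observable (prod_lattice Ls) g h"
    unfolding observable_def
  proof (intro ballI impI)
    fix x y :: "'n \<Rightarrow> 'p \<Rightarrow> 'a"
    assume x: "x \<in> points (prod_lattice Ls)" and y: "y \<in> points (prod_lattice Ls)"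
      and "x \<noteq> y"
    then obtain i where "(\<lambda>k. x k i) \<noteq> (\<lambda>k. y k i)"
      by (auto simp: fun_eq_iff)
    then obtain u where u: "u \<in> controls (Ls i)"
      and diff: "out_seq (Ls i) g h (\<lambda>k. x k i) u \<noteq> out_seq (Ls i) g h (\<lambda>k. y k i) u"
      using obs component_in_points[OF x] component_in_points[OF y]
      unfolding observable_def by blast
    \<comment> \<open>Only the distinguishing component of the control is prescribed; the other
      factors receive arbitrary inputs.\<close>
    obtain u' where u': "u' \<in> controls (prod_lattice Ls)" "(\<lambda>t k. u' t k i) = u"
      using ex_control_component[of Ls, OF ne u] by blast
    have "out_seq (prod_lattice Ls) g h x u' \<noteq> out_seq (prod_lattice Ls) g h y u'"
    proof
      assume "out_seq (prod_lattice Ls) g h x u' = out_seq (prod_lattice Ls) g h y u'"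
      then have "out_seq (Ls i) g h (\<lambda>k. x k i) u t l = out_seq (Ls i) g h (\<lambda>k. y k i) u t l"
        for t l
        using out_seq_component[OF L x u'(1), of g h t l i]
          out_seq_component[OF L y u'(1), of g h t l i] u'(2) by simp
      with diff show False by blast
    qed
    with u'(1) show "\<exists>u\<in>controls (prod_lattice Ls).
        out_seq (prod_lattice Ls) g h x u \<noteq> out_seq (prod_lattice Ls) g h y u"
      by blast
  qed
qed

text \<open>Nodes of the product agree exactly when they agree in every component. Synchrony is
  required from some time on, so a common later threshold preserves it in each factor.\<close>

lemma synchronizable_prod_lattice:
  fixes g :: "'n \<Rightarrow> ('n + 'm) lattice_expr"
  shows "synchronizable (prod_lattice Ls) g \<longleftrightarrow> (\<forall>i. synchronizable (Ls i) g)"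
proof
  assume sync: "synchronizable (prod_lattice Ls) g"
  show "\<forall>i. synchronizable (Ls i) g"
    unfolding synchronizable_def
  proof (intro allI ballI)
    fix i and x :: "'n \<Rightarrow> 'a"
    assume "x \<in> points (Ls i)"
    then obtain x' where x': "x' \<in> points (prod_lattice Ls)" "(\<lambda>k. x' k i) = x"
      by (rule ex_point_component[of Ls, OF ne])
    obtain u T where u: "u \<in> controls (prod_lattice Ls)"
      and tr: "\<And>t j k. T \<le> t \<Longrightarrow>
        trajectory (prod_lattice Ls) g x' u t j = trajectory (prod_lattice Ls) g x' u t k"
      using sync x'(1) unfolding synchronizable_def by blast
    have "trajectory (Ls i) g x (\<lambda>t k. u t k i) t j =
        trajectory (Ls i) g x (\<lambda>t k. u t k i) t k" if "T \<le> t" for t j k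
      using tr[OF that, of j k] trajectory_component[OF L x'(1) u, of g t _ i] x'(2) by metis
    then show "\<exists>u\<in>controls (Ls i). \<exists>T. \<forall>t\<ge>T. \<forall>j k.
        trajectory (Ls i) g x u t j = trajectory (Ls i) g x u t k"
      using component_in_controls[OF u] by blast
  qed
next
  assume sync: "\<forall>i. synchronizable (Ls i) g"
  show "synchronizable (prod_lattice Ls) g"
    unfolding synchronizable_def
  proof (intro ballI)
    fix x :: "'n \<Rightarrow> 'p \<Rightarrow> 'a"
    assume x: "x \<in> points (prod_lattice Ls)"
    have "\<forall>i. \<exists>u. u \<in> controls (Ls i) \<and> (\<exists>T. \<forall>t\<ge>T. \<forall>j k.
        trajectory (Ls i) g (\<lambda>k. x k i) u t j = trajectory (Ls i) g (\<lambda>k. x k i) u t k)"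
      using sync component_in_points[OF x] unfolding synchronizable_def by blast
    from choice[OF this] obtain u where u: "\<forall>i. u i \<in> controls (Ls i)"
      and "\<forall>i. \<exists>T. \<forall>t\<ge>T. \<forall>j k.
        trajectory (Ls i) g (\<lambda>k. x k i) (u i) t j = trajectory (Ls i) g (\<lambda>k. x k i) (u i) t k"
      by blast
    from ex_common_bound[OF this(2)] obtain T where tr: "\<And>i t j k. T \<le> t \<Longrightarrow>
        trajectory (Ls i) g (\<lambda>k. x k i) (u i) t j = trajectory (Ls i) g (\<lambda>k. x k i) (u i) t k"
      by blast
    let ?u = "\<lambda>t k i. u i t k"
    have u': "?u \<in> controls (prod_lattice Ls)"
      using u by (simp add: tuple_in_controls)
    have "trajectory (prod_lattice Ls) g x ?u t j = trajectory (prod_lattice Ls) g x ?u t k"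
      if "T \<le> t" for t j k
    proof
      fix i
      show "trajectory (prod_lattice Ls) g x ?u t j i = trajectory (prod_lattice Ls) g x ?u t k i"
        unfolding trajectory_component[OF L x u'] by (rule tr[OF that])
    qed
    with u' show "\<exists>u\<in>controls (prod_lattice Ls). \<exists>T. \<forall>t\<ge>T. \<forall>j k.
        trajectory (prod_lattice Ls) g x u t j = trajectory (prod_lattice Ls) g x u t k"
      by blast
  qed
qed

text \<open>Target states are projected or tupled along with the trajectories, and the settling
  times are bounded by their maximum.\<close>

lemma stabilizable_prod_lattice:
  fixes g :: "'n \<Rightarrow> ('n + 'm) lattice_expr"
  shows "stabilizable (prod_lattice Ls) g \<longleftrightarrow> (\<forall>i. stabilizable (Ls i) g)"
proof
  assume "stabilizable (prod_lattice Ls) g"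
  then obtain xe where xe: "xe \<in> points (prod_lattice Ls)"
    and stab: "\<And>x. x \<in> points (prod_lattice Ls) \<Longrightarrow>
      \<exists>u\<in>controls (prod_lattice Ls). \<exists>T. \<forall>t\<ge>T. trajectory (prod_lattice Ls) g x u t = xe"
    unfolding stabilizable_def by blast
  show "\<forall>i. stabilizable (Ls i) g"
    unfolding stabilizable_def
  \<comment> \<open>The target for factor \<open>i\<close> is the \<open>i\<close>-th component of
    \<open>xe\<close>, fixed before the initial state is introduced.\<close>
  proof (intro allI bexI[OF _ component_in_points[OF xe]] ballI)
    fix i and x :: "'n \<Rightarrow> 'a"
    assume "x \<in> points (Ls i)"
    then obtain x' where x': "x' \<in> points (prod_lattice Ls)" "(\<lambda>k. x' k i) = x"
      by (rule ex_point_component[of Ls, OF ne])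
    obtain u T where u: "u \<in> controls (prod_lattice Ls)"
      and tr: "\<And>t. T \<le> t \<Longrightarrow> trajectory (prod_lattice Ls) g x' u t = xe"
      using stab[OF x'(1)] by blast
    have "trajectory (Ls i) g x (\<lambda>t k. u t k i) t = (\<lambda>k. xe k i)" if "T \<le> t" for t
      using tr[OF that] trajectory_component[OF L x'(1) u, of g t _ i] x'(2)
      by (auto simp: fun_eq_iff)
    then show "\<exists>u\<in>controls (Ls i). \<exists>T. \<forall>t\<ge>T. trajectory (Ls i) g x u t = (\<lambda>k. xe k i)"
      using component_in_controls[OF u] by blast
  qed
next
  assume "\<forall>i. stabilizable (Ls i) g"
  \<comment> \<open>One target per factor is chosen here, independently of any initial state, so
    that their tuple can serve as the target of the product.\<close>
  then obtain xe where xe: "\<And>i. xe i \<in> points (Ls i)"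
    and stab: "\<And>i x. x \<in> points (Ls i) \<Longrightarrow>
      \<exists>u\<in>controls (Ls i). \<exists>T. \<forall>t\<ge>T. trajectory (Ls i) g x u t = xe i"
    unfolding stabilizable_def by metis
  show "stabilizable (prod_lattice Ls) g"
    unfolding stabilizable_def
  proof (intro bexI[of _ "\<lambda>k i. xe i k"] ballI)
    show "(\<lambda>k i. xe i k) \<in> points (prod_lattice Ls)"
      using xe by (simp add: tuple_in_points)
  next
    fix x :: "'n \<Rightarrow> 'p \<Rightarrow> 'a"
    assume x: "x \<in> points (prod_lattice Ls)"
    have "\<forall>i. \<exists>u. u \<in> controls (Ls i) \<and>
        (\<exists>T. \<forall>t\<ge>T. trajectory (Ls i) g (\<lambda>k. x k i) u t = xe i)"
      using stab[OF component_in_points[OF x]] by blast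
    from choice[OF this] obtain u where u: "\<forall>i. u i \<in> controls (Ls i)"
      and "\<forall>i. \<exists>T. \<forall>t\<ge>T. trajectory (Ls i) g (\<lambda>k. x k i) (u i) t = xe i"
      by blast
    from ex_common_bound[OF this(2)] obtain T where
      tr: "\<And>i t. T \<le> t \<Longrightarrow> trajectory (Ls i) g (\<lambda>k. x k i) (u i) t = xe i"
      by blast
    have u': "(\<lambda>t k i. u i t k) \<in> controls (prod_lattice Ls)"
      using u by (simp add: tuple_in_controls)
    have "trajectory (prod_lattice Ls) g x (\<lambda>t k i. u i t k) t = (\<lambda>k i. xe i k)"
      if "T \<le> t" for t
      by (rule trajectory_eqI[OF x u']) (simp add: tr[OF that])
    with u' show "\<exists>u\<in>controls (prod_lattice Ls). \<exists>T. \<forall>t\<ge>T.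
        trajectory (prod_lattice Ls) g x u t = (\<lambda>k i. xe i k)"
      by blast
  qed
qed

end

theorem theorem3:
  fixes Ls :: "'p::finite \<Rightarrow> 'a gorder"
    and g :: "'n::finite \<Rightarrow> ('n + 'm::finite) lattice_expr"
    and h :: "'q::finite \<Rightarrow> 'n lattice_expr"
  assumes "\<And>i. lattice (Ls i)"
    and "\<And>i. finite (carrier (Ls i))"
    and "\<And>i. carrier (Ls i) \<noteq> {}"
  shows "(controllable (prod_lattice Ls) g \<longleftrightarrow> (\<forall>i. controllable (Ls i) g)) \<and>
    (observable (prod_lattice Ls) g h \<longleftrightarrow> (\<forall>i. observable (Ls i) g h)) \<and>
    (synchronizable (prod_lattice Ls) g \<longleftrightarrow> (\<forall>i. synchronizable (Ls i) g)) \<and>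
    (stabilizable (prod_lattice Ls) g \<longleftrightarrow> (\<forall>i. stabilizable (Ls i) g))"
  by (intro conjI controllable_prod_lattice observable_prod_lattice
      synchronizable_prod_lattice stabilizable_prod_lattice assms(1,3))

end
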